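(* Let $S$ be an arborescent poset with consistent anti-linearization $v:S\to[1,m]$ which is bijective, let $\lambda=(\lambda_1>\dots>\lambda_m\ge0)$ be regular, and let $\mathbb D_S=\mathbb D_S^v(\lambda)\subset\mathbb S_m\lambda$ be the poset of $S$-dominant compositions with the induced Bruhat order. For $a\preceq b$ in $\mathbb D_S$ the Möbius function of $\mathbb D_S$ is $$\mu^{\mathbb D_S}(a,b)=\begin{cases}(-1)^{\mathrm{rk}(b)-\mathrm{rk}(a)},&\text{if the open intervals } (a,b)^{\mathbb S_m\lambda}\text{ and }(a,b)^{\mathbb D_S}\text{ coincide},\\0,&\text{otherwise.}\end{cases}$$ In other words, the Möbius function equals $\pm1$ if every $c\in\mathbb S_m\lambda$ with $a\prec c\prec b$ is $S$-dominant, and is zero otherwise.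
   Context: An arborescent poset with consistent anti-linearization is a finite poset $(S,\preceq)$ with an injective order-reversing map $v:S\to[1,m]$ ($s\succ t\Rightarrow v(s)<v(t)$) such that for every $s\in S$ the set $\{t:t\succeq s\}$ equals $v^{-1}([a_s,b_s])$ for some $a_s\le b_s$. A composition $d\in\mathbb Z_{\ge0}^m$ is $S$-dominant if $d_l=0$ for $l\notin v(S)$ and $d_{v(s)}\ge d_{v(t)}$ whenever $s\succ t$. $\mathbb S_m\lambda$ is the set of rearrangements of $\lambda$; the Bruhat order on it is the reflexive transitive closure of $a\prec(ij)a$ whenever $i<j$ and $a_i>a_j$, where $(ij)a$ exchanges the $i$-th and $j$-th entries. The poset $\mathbb D_S$ is graded and $\mathrm{rk}$ is its rank function, $\mathrm{rk}(d)=\#\{i<j:d_i<d_j\}$. The Möbius function of a finite poset: $\mu(x,x)=1$, $\mu(x,y)=-\sum_{x\le z<y}\mu(x,z)$ for $x<y$, $\mu(x,y)=0$ if $x\not\le y$. $(a,b)^X=\{c\in X:a\prec c\prec b\}$. *)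

theory Defs
  imports "HOL-Combinatorics.Combinatorics"
begin

text \<open>
  Posets are given by a carrier \<open>A\<close> and a relation \<open>r\<close> with \<^term>\<open>partial_order_on A r\<close>, where
  \<open>(x, y) \<in> r\<close> means that \<open>x\<close> is below or equal to \<open>y\<close>.
\<close>

definition open_interval :: "'a rel \<Rightarrow> 'a \<Rightarrow> 'a \<Rightarrow> 'a set" where
  "open_interval r x y = {z. (x, z) \<in> r \<and> (z, y) \<in> r \<and> z \<noteq> x \<and> z \<noteq> y}"

text \<open>The guard \<open>finite A \<and> partial_order_on A r\<close> only serves termination.\<close>

function moebius :: "'a set \<Rightarrow> 'a rel \<Rightarrow> 'a \<Rightarrow> 'a \<Rightarrow> int" where
  "moebius A r x y =
     (if finite A \<and> partial_order_on A r \<and> (x, y) \<in> r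
      then if x = y then 1
           else - (\<Sum>z \<in> {z. (x, z) \<in> r \<and> (z, y) \<in> r \<and> z \<noteq> y}. moebius A r x z)
      else 0)"
  by pat_completeness auto
termination
proof (relation "Wellfounded.measure (\<lambda>(A, r, x, y). card {z \<in> A. (z, y) \<in> r})", goal_cases)
  case 1
  show ?case by simp
next
  case (2 A r x y z)
  have po: "r \<subseteq> A \<times> A" "trans r" "antisym r" "\<forall>x\<in>A. (x, x) \<in> r"
    using 2 by (auto simp: partial_order_on_def preorder_on_def refl_on_def)
  have zy: "(z, y) \<in> r" "z \<noteq> y" using 2 by auto
  have "{w \<in> A. (w, z) \<in> r} \<subset> {w \<in> A. (w, y) \<in> r}"
  proof
    show "{w \<in> A. (w, z) \<in> r} \<subseteq> {w \<in> A. (w, y) \<in> r}"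
      using po zy by (auto dest: transD)
    have "y \<in> {w \<in> A. (w, y) \<in> r}" "y \<notin> {w \<in> A. (w, z) \<in> r}"
      using po zy by (auto dest: antisymD)
    then show "{w \<in> A. (w, z) \<in> r} \<noteq> {w \<in> A. (w, y) \<in> r}" by blast
  qed
  with 2 show ?case by (auto intro: psubset_card_mono)
qed

declare moebius.simps [simp del]

lemma
  assumes "finite A" "partial_order_on A r"
  shows moebius_refl: "x \<in> A \<Longrightarrow> moebius A r x x = 1"
    and moebius_less: "(x, y) \<in> r \<Longrightarrow> x \<noteq> y \<Longrightarrow>
      moebius A r x y = - (\<Sum>z \<in> {z. (x, z) \<in> r \<and> (z, y) \<in> r \<and> z \<noteq> y}. moebius A r x z)"
    and moebius_not_le: "(x, y) \<notin> r \<Longrightarrow> moebius A r x y = 0"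
  using assms
  by (subst moebius.simps, force simp: partial_order_on_def preorder_on_def refl_on_def)+


definition consistent_anti_linearization ::
    "nat \<Rightarrow> 'a set \<Rightarrow> 'a rel \<Rightarrow> ('a \<Rightarrow> nat) \<Rightarrow> bool" where
  "consistent_anti_linearization m S r v \<longleftrightarrow>
     finite S \<and> partial_order_on S r \<and>
     v ` S \<subseteq> {1..m} \<and> inj_on v S \<and>
     (\<forall>s\<in>S. \<forall>t\<in>S. (t, s) \<in> r \<and> s \<noteq> t \<longrightarrow> v s < v t) \<and>
     (\<forall>s\<in>S. \<exists>p q. p \<le> q \<and> {t \<in> S. (s, t) \<in> r} = {t \<in> S. v t \<in> {p..q}})"

text \<open>
  Compositions of length \<open>m\<close> are functions on \<^typ>\<open>nat\<close> whose entries are the values at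
  \<open>1, \<dots>, m\<close>; all other values are \<open>0\<close>, so that equality of compositions is equality of functions.
\<close>

type_synonym composition = "nat \<Rightarrow> nat"

definition compositions :: "nat \<Rightarrow> composition set" where
  "compositions m = {d. \<forall>l. l \<notin> {1..m} \<longrightarrow> d l = 0}"

definition rearrangements :: "nat \<Rightarrow> composition \<Rightarrow> composition set" where
  "rearrangements m lam = {lam \<circ> p | p. p permutes {1..m}}"

definition bruhat_step :: "nat \<Rightarrow> composition rel" where
  "bruhat_step m =
     {(a, a \<circ> transpose i j) | a i j. i \<in> {1..m} \<and> j \<in> {1..m} \<and> i < j \<and> a i > a j}"

definition bruhat :: "nat \<Rightarrow> composition \<Rightarrow> composition rel" where
  "bruhat m lam = Restr ((bruhat_step m)\<^sup>*) (rearrangements m lam)"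

definition rk :: "nat \<Rightarrow> composition \<Rightarrow> nat" where
  "rk m d = card {(i, j). i \<in> {1..m} \<and> j \<in> {1..m} \<and> i < j \<and> d i < d j}"

definition dominant ::
    "nat \<Rightarrow> 'a set \<Rightarrow> 'a rel \<Rightarrow> ('a \<Rightarrow> nat) \<Rightarrow> composition \<Rightarrow> bool" where
  "dominant m S r v d \<longleftrightarrow>
     (\<forall>l \<in> {1..m} - v ` S. d l = 0) \<and>
     (\<forall>s\<in>S. \<forall>t\<in>S. (t, s) \<in> r \<and> s \<noteq> t \<longrightarrow> d (v s) \<ge> d (v t))"

definition dominant_rearrangements ::
    "nat \<Rightarrow> 'a set \<Rightarrow> 'a rel \<Rightarrow> ('a \<Rightarrow> nat) \<Rightarrow> composition \<Rightarrow> composition set" where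
  "dominant_rearrangements m S r v lam = {d \<in> rearrangements m lam. dominant m S r v d}"

definition dominant_bruhat ::
    "nat \<Rightarrow> 'a set \<Rightarrow> 'a rel \<Rightarrow> ('a \<Rightarrow> nat) \<Rightarrow> composition \<Rightarrow> composition rel" where
  "dominant_bruhat m S r v lam = Restr (bruhat m lam) (dominant_rearrangements m S r v lam)"


text \<open>
  Both orders are finite posets, so the guard in \<open>moebius\<close> is met. Antisymmetry holds because
  the weight \<open>\<Sum>l. l * d l\<close> increases strictly along every step.
\<close>

lemma finite_rearrangements: "finite (rearrangements m lam)"
proof -
  have "rearrangements m lam = (\<lambda>p. lam \<circ> p) ` {p. p permutes {1..m}}"
    by (auto simp: rearrangements_def)
  then show ?thesis by (simp add: finite_permutations)
qed

lemma bruhat_step_weight: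
  assumes "(a, b) \<in> bruhat_step m"
  shows "(\<Sum>l\<in>{1..m}. l * a l) < (\<Sum>l\<in>{1..m}. l * b l)"
proof -
  from assms obtain i j where b: "b = a \<circ> transpose i j"
    and ij: "i \<in> {1..m}" "j \<in> {1..m}" "i < j" "a j < a i"
    by (auto simp: bruhat_step_def)
  have split: "(\<Sum>l\<in>{1..m}. l * d l) = i * d i + (j * d j + (\<Sum>l\<in>{1..m} - {i} - {j}. l * d l))"
    for d :: "nat \<Rightarrow> nat"
    using ij by (subst sum.remove[of _ i], simp, simp, subst sum.remove[of _ j], auto)
  have rest: "(\<Sum>l\<in>{1..m} - {i} - {j}. l * a l) = (\<Sum>l\<in>{1..m} - {i} - {j}. l * b l)"
    by (rule sum.cong) (auto simp: b transpose_def)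
  obtain e where e: "j = i + e" "e > 0" using ij(3) less_imp_add_positive by blast
  have "i * a i + j * a j < i * a j + j * a i"
    using e ij(4) by (simp add: algebra_simps)
  with rest show ?thesis unfolding split[of a] split[of b] by (simp add: b)
qed

lemma bruhat_weight:
  assumes "(a, b) \<in> (bruhat_step m)\<^sup>*"
  shows "a = b \<or> (\<Sum>l\<in>{1..m}. l * a l) < (\<Sum>l\<in>{1..m}. l * b l)"
  using assms by induction (auto dest: bruhat_step_weight)

lemma partial_order_bruhat: "partial_order_on (rearrangements m lam) (bruhat m lam)"
proof -
  have "antisym ((bruhat_step m)\<^sup>*)"
    by (rule antisymI) (metis bruhat_weight less_asym)
  moreover have "trans ((bruhat_step m)\<^sup>*)" by (rule trans_rtrancl)
  ultimately show ?thesis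
    unfolding bruhat_def partial_order_on_def preorder_on_def refl_on_def antisym_def trans_def
    by blast
qed

lemma partial_order_dominant_bruhat:
  "partial_order_on (dominant_rearrangements m S r v lam) (dominant_bruhat m S r v lam)"
  using partial_order_bruhat[of m lam]
  unfolding dominant_bruhat_def dominant_rearrangements_def
    partial_order_on_def preorder_on_def refl_on_def antisym_def trans_def
  by blast

lemma finite_dominant_rearrangements: "finite (dominant_rearrangements m S r v lam)"
  by (simp add: dominant_rearrangements_def finite_rearrangements)

end

(*
  Composing with \<lambda> identifies S-dominant compositions with the permutations p satisfying p i < p j for
  all pairs (i, j) of positions of comparable elements. Let s exchange the values k and k+1. Each
  dominant p is of one of three types: a descent (s p < p, and then s p is dominant), an ascent with
  s p dominant, or blocked (s p > p is not dominant). The lifting property of the Bruhat order holds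
  inside the dominant poset if s is taken to fix the blocked elements; the crucial point is that a
  dominant z \<le> s y with y blocked satisfies z \<le> y, which is where consistency of v enters.

  Lifting alone yields, for a descent b, that \<mu>(a, b) is 0, -\<mu>(a, s b) or \<mu>(s a, s b) according to
  whether a is blocked, an ascent or a descent, and that \<mu>(a, b) = 0 for a an ascent and b blocked.
  The claimed formula obeys the same recursion: if the full interval [a, b] left the dominant set at
  c while the smaller interval did not, then s c would be blocked and \<mu>(x, s c) = 0 for an ascent
  x, whereas induction gives \<mu>(x, s c) = 1 or -1.
*)

theory Submission
  imports Defs
begin

section \<open>Moebius functions of posets with a lifting property\<close>

text \<open>
  \<open>s\<close> exchanges the ascents \<open>U\<close> with the descents \<open>L\<close>; on the blocked elements \<open>F\<close> its value is
  irrelevant.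
\<close>

locale lifting_poset =
  fixes A :: "'a set" and r :: "'a rel" and U L F :: "'a set" and s :: "'a \<Rightarrow> 'a"
  assumes finite: "finite A" and po: "partial_order_on A r"
    and cover: "A = U \<union> L \<union> F"
    and disjoint: "U \<inter> L = {}" "U \<inter> F = {}" "L \<inter> F = {}"
    and s_up: "x \<in> U \<Longrightarrow> s x \<in> L" and s_down: "x \<in> L \<Longrightarrow> s x \<in> U"
    and s_s: "x \<in> U \<union> L \<Longrightarrow> s (s x) = x"
    and up_le: "x \<in> U \<Longrightarrow> (x, s x) \<in> r"
    and lift_down: "(x, y) \<in> r \<Longrightarrow> x \<in> U \<union> F \<Longrightarrow> y \<in> L \<Longrightarrow> (x, s y) \<in> r"
    and lift_up: "(x, y) \<in> r \<Longrightarrow> x \<in> U \<Longrightarrow> y \<in> L \<union> F \<Longrightarrow> (s x, y) \<in> r"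
begin

lemma le_trans: "(x, y) \<in> r \<Longrightarrow> (y, z) \<in> r \<Longrightarrow> (x, z) \<in> r"
  using po by (auto simp: partial_order_on_def preorder_on_def dest: transD)

lemma le_antisym: "(x, y) \<in> r \<Longrightarrow> (y, x) \<in> r \<Longrightarrow> x = y"
  using po by (auto simp: partial_order_on_def dest: antisymD)

lemma le_refl: "x \<in> A \<Longrightarrow> (x, x) \<in> r"
  using po by (auto simp: partial_order_on_def preorder_on_def refl_on_def)

lemma le_carrier: "(x, y) \<in> r \<Longrightarrow> x \<in> A \<and> y \<in> A"
  using po by (auto simp: partial_order_on_def preorder_on_def refl_on_def)

lemma down_le: "x \<in> L \<Longrightarrow> (s x, x) \<in> r"
  using up_le[of "s x"] s_down s_s by auto

definition icc :: "'a \<Rightarrow> 'a \<Rightarrow> 'a set" where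
  "icc x y = {z. (x, z) \<in> r \<and> (z, y) \<in> r}"

lemma finite_icc: "finite (icc x y)"
  by (rule finite_subset[OF _ finite]) (auto simp: icc_def dest: le_carrier)

abbreviation mu :: "'a \<Rightarrow> 'a \<Rightarrow> int" where "mu \<equiv> moebius A r"

lemma sum_mu:
  assumes "x \<noteq> y" shows "(\<Sum>z\<in>icc x y. mu x z) = 0"
proof (cases "(x, y) \<in> r")
  case True
  have "icc x y = insert y {z. (x, z) \<in> r \<and> (z, y) \<in> r \<and> z \<noteq> y}"
    using True by (auto simp: icc_def le_refl dest: le_carrier)
  moreover have "finite {z. (x, z) \<in> r \<and> (z, y) \<in> r \<and> z \<noteq> y}"
    by (rule finite_subset[OF _ finite_icc]) (auto simp: icc_def)
  ultimately show ?thesis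
    using moebius_less[OF finite po True assms] by simp
next
  case False
  then have "icc x y = {}" by (auto simp: icc_def dest: le_trans)
  then show ?thesis by simp
qed

text \<open>The down-set of a strictly smaller element has fewer members, so its cardinality serves
  as the measure.\<close>

lemma below_induct [consumes 1, case_names step]:
  assumes "b \<in> A"
    and "\<And>b. b \<in> A \<Longrightarrow> (\<And>z. (z, b) \<in> r \<Longrightarrow> z \<noteq> b \<Longrightarrow> P z) \<Longrightarrow> P b"
  shows "P b"
proof -
  have below_less: "card {w. (w, z) \<in> r} < card {w. (w, y) \<in> r}" if "(z, y) \<in> r" "z \<noteq> y" for z y
  proof (rule psubset_card_mono)
    show "finite {w. (w, y) \<in> r}"
      by (rule finite_subset[OF _ finite]) (auto dest: le_carrier)
    have "y \<in> {w. (w, y) \<in> r}" "y \<notin> {w. (w, z) \<in> r}"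
      using that le_refl le_carrier le_antisym by blast+
    moreover have "{w. (w, z) \<in> r} \<subseteq> {w. (w, y) \<in> r}"
      using that le_trans by blast
    ultimately show "{w. (w, z) \<in> r} \<subset> {w. (w, y) \<in> r}" by blast
  qed
  show ?thesis
    using assms(1)
  proof (induction "card {w. (w, b) \<in> r}" arbitrary: b rule: less_induct)
    case less
    then show ?case using assms(2) below_less le_carrier by metis
  qed
qed

text \<open>For \<open>b\<close> outside \<open>U\<close> the map \<open>s\<close> matches the
  descents in \<open>icc a b\<close> with its ascents: \<open>lift_down\<close> keeps the images
  above \<open>a\<close>, \<open>lift_up\<close> keeps them below \<open>b\<close>. By induction
  every matched pair and every blocked element contributes 0 to the vanishing sum over the interval,
  except the group containing \<open>b\<close>.\<close>

lemma mu_from_up: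
  assumes "b \<in> A" "a \<in> U" "(a, b) \<in> r"
  shows "(b \<in> F \<longrightarrow> mu a b = 0) \<and> (b \<in> L \<longrightarrow> mu a b = - mu a (s b))"
  using assms
proof (induction b rule: below_induct)
  case (step b)
  let ?I = "icc a b"
  have IH: "z \<in> F \<Longrightarrow> mu a z = 0" "z \<in> L \<Longrightarrow> mu a z = - mu a (s z)" if "z \<in> ?I" "z \<noteq> b" for z
    using step.IH[of z] that step.prems by (auto simp: icc_def)
  have "mu a b = (if b \<in> F then 0 else - mu a (s b))" if b: "b \<in> L \<union> F"
  proof -
    have "b \<noteq> a" using b step.prems disjoint by blast
    then have zero: "(\<Sum>z\<in>?I. mu a z) = 0" by (intro sum_mu) simp
    have "s ` (?I \<inter> L) = ?I \<inter> U"
    proof safe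
      fix z assume z: "z \<in> ?I" "z \<in> L"
      then show "s z \<in> U" by (rule_tac s_down)
      show "s z \<in> ?I"
        using z step.prems lift_down[of a z] down_le[of z] le_trans[of "s z" z b]
        by (auto simp: icc_def)
    next
      fix z assume z: "z \<in> ?I" "z \<in> U"
      then have "s z \<in> ?I" "s z \<in> L" "s (s z) = z"
        using lift_up[of z b] b up_le[of z] le_trans[of a z "s z"] s_up[of z] s_s[of z]
        by (auto simp: icc_def)
      then show "z \<in> s ` (?I \<inter> L)" by (metis IntI image_eqI)
    qed
    moreover have "inj_on s (?I \<inter> L)"
      by (rule inj_on_inverseI[of _ s]) (simp add: s_s)
    ultimately have pairs: "(\<Sum>z\<in>?I \<inter> U. mu a z) = (\<Sum>z\<in>?I \<inter> L. mu a (s z))"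
      by (metis (no_types, lifting) comp_apply sum.cong sum.reindex)
    have "?I = ((?I \<inter> U) \<union> (?I \<inter> L)) \<union> (?I \<inter> F)"
      using cover le_carrier by (auto simp: icc_def)
    then have "(\<Sum>z\<in>?I. mu a z) = (\<Sum>z\<in>((?I \<inter> U) \<union> (?I \<inter> L)) \<union> (?I \<inter> F). mu a z)"
      by simp
    also have "\<dots> = (\<Sum>z\<in>?I \<inter> U. mu a z) + (\<Sum>z\<in>?I \<inter> L. mu a z) + (\<Sum>z\<in>?I \<inter> F. mu a z)"
      using disjoint finite_icc by (subst sum.union_disjoint, auto)+
    finally have split: "(\<Sum>z\<in>?I \<inter> L. mu a z + mu a (s z)) + (\<Sum>z\<in>?I \<inter> F. mu a z) = 0"
      using zero pairs by (simp add: sum.distrib)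
    have bI: "b \<in> ?I" using step.prems step.hyps le_refl by (auto simp: icc_def)
    show ?thesis
    proof (cases "b \<in> F")
      case True
      then have "b \<notin> L" using disjoint by blast
      then have "(\<Sum>z\<in>?I \<inter> L. mu a z + mu a (s z)) = 0"
        using IH(2) by (intro sum.neutral) fastforce
      moreover have "(\<Sum>z\<in>?I \<inter> F. mu a z) = (\<Sum>z\<in>{b}. mu a z)"
        using bI True IH(1) finite_icc by (intro sum.mono_neutral_right) auto
      ultimately show ?thesis using split True by simp
    next
      case False
      then have bL: "b \<in> L" using b by blast
      have "(\<Sum>z\<in>?I \<inter> L. mu a z + mu a (s z)) = (\<Sum>z\<in>{b}. mu a z + mu a (s z))"
        using bI bL IH(2) finite_icc by (intro sum.mono_neutral_right) auto
      moreover have "(\<Sum>z\<in>?I \<inter> F. mu a z) = 0"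
        using False IH(1) by (intro sum.neutral) auto
      ultimately show ?thesis using split False by simp
    qed
  qed
  then show ?case using disjoint by auto
qed

text \<open>By \<open>lift_down\<close>, an ascent or blocked element below \<open>b\<close> is
  already below \<open>s b\<close>, so only descents remain. The sum is a difference of two sums
  that vanish by \<open>sum_mu\<close>, also when \<open>x\<close> is not below
  \<open>s b\<close>.\<close>

lemma sum_mu_L:
  assumes "b \<in> L" "x \<noteq> b" "x \<noteq> s b"
  shows "(\<Sum>z\<in>icc x b - icc x (s b). mu x z) = 0" "icc x b - icc x (s b) \<subseteq> L"
proof -
  have "icc x (s b) \<subseteq> icc x b"
    using le_trans[OF _ down_le[OF assms(1)]] by (auto simp: icc_def)
  then show "(\<Sum>z\<in>icc x b - icc x (s b). mu x z) = 0"
    using sum_mu assms finite_icc by (simp add: sum_diff)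
  show "icc x b - icc x (s b) \<subseteq> L"
    using cover lift_down assms(1) le_carrier by (auto simp: icc_def)
qed

lemma not_le_down: "b \<in> L \<Longrightarrow> (b, s b) \<notin> r"
  using down_le le_antisym s_down disjoint(1) by (metis IntI empty_iff)

text \<open>Singling out the term \<open>b\<close> gives a recursion for \<open>mu x b\<close> that
  runs through descents only.\<close>

lemma mu_L_eq:
  assumes "b \<in> L" "x \<noteq> b" "x \<noteq> s b" "(x, b) \<in> r"
  shows "mu x b = - (\<Sum>z\<in>icc x b - icc x (s b) - {b}. mu x z)"
proof -
  have "b \<in> icc x b - icc x (s b)"
    using assms not_le_down le_refl le_carrier by (auto simp: icc_def)
  then show ?thesis
    using sum_mu_L(1)[OF assms(1-3)] finite_icc by (simp add: sum.remove)
qed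

text \<open>The recursion of \<open>mu_L_eq\<close> involves only smaller descents, whose values
  vanish by induction.\<close>

lemma mu_from_fixed:
  assumes "b \<in> A" "a \<in> F" "b \<in> L"
  shows "mu a b = 0"
  using assms
proof (induction b rule: below_induct)
  case (step b)
  show ?case
  proof (cases "(a, b) \<in> r")
    case True
    have ne: "a \<noteq> b" "a \<noteq> s b" using step.prems disjoint s_down by blast+
    have "mu a z = 0" if "z \<in> icc a b - icc a (s b) - {b}" for z
      using step.IH[of z] step.prems that sum_mu_L(2)[OF step.prems(2) ne] by (auto simp: icc_def)
    then show ?thesis using mu_L_eq[OF step.prems(2) ne True] by simp
  qed (simp add: moebius_not_le[OF finite po])
qed

text \<open>The recursions for \<open>a\<close> and for \<open>s a\<close> run over the same
  descents, because \<open>lift_up\<close> puts every descent above \<open>s a\<close> also above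
  \<open>a\<close>. The induction starts at \<open>a = b\<close>, where \<open>mu_from_up\<close>
  supplies the sign.\<close>

lemma mu_from_down:
  assumes "b \<in> A" "a \<in> L" "b \<in> L" "(a, b) \<in> r"
  shows "mu a b = - mu (s a) b"
  using assms
proof (induction b rule: below_induct)
  case (step b)
  have a: "s a \<in> U" "s (s a) = a" "(s a, a) \<in> r" "a \<in> A"
    using step.prems s_down s_s down_le cover by auto
  show ?case
  proof (cases "a = b")
    case True
    have "mu (s a) a = - mu (s a) (s a)"
      using mu_from_up[OF a(4,1,3)] step.prems by simp
    then show ?thesis using True moebius_refl[OF finite po] a cover by simp
  next
    case False
    have ne: "a \<noteq> s b" "s a \<noteq> b" "s a \<noteq> s b"
      using step.prems disjoint s_down False s_s[of a] s_s[of b] by auto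
    have eq: "icc a b - icc a (s b) = icc (s a) b - icc (s a) (s b)" (is "?X = ?Y")
    proof
      show "?X \<subseteq> ?Y" using le_trans[OF a(3)] by (auto simp: icc_def)
      show "?Y \<subseteq> ?X"
      proof
        fix z assume z: "z \<in> ?Y"
        then have "z \<in> L" using sum_mu_L(2)[OF step.prems(2) ne(2,3)] by blast
        then have "(a, z) \<in> r" using lift_up[of "s a" z] a z by (auto simp: icc_def)
        then show "z \<in> ?X" using z by (auto simp: icc_def)
      qed
    qed
    have "mu a z = - mu (s a) z" if "z \<in> ?X - {b}" for z
      using step.IH[of z] step.prems that sum_mu_L(2)[OF step.prems(2) False ne(1)]
      by (auto simp: icc_def)
    then have "mu a b = (\<Sum>z\<in>?X - {b}. mu (s a) z)"
      using mu_L_eq[OF step.prems(2) False ne(1) step.prems(3)] by (simp add: sum_negf)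
    also have "\<dots> = - mu (s a) b"
      using mu_L_eq[OF step.prems(2) ne(2,3) le_trans[OF a(3) step.prems(3)]] eq by simp
    finally show ?thesis .
  qed
qed

lemma mu_down_down:
  assumes "a \<in> L" "b \<in> L" "(a, b) \<in> r"
  shows "mu a b = mu (s a) (s b)"
proof -
  have "b \<in> A" "s a \<in> U" "(s a, b) \<in> r"
    using assms s_down le_trans[OF down_le] cover by auto
  then show ?thesis
    using mu_from_down[of b a] mu_from_up[of b "s a"] assms by simp
qed

end

section \<open>Bruhat order on permutations\<close>

text \<open>For fixed \<open>i\<close>, comparing these counts at all thresholds \<open>c\<close>
  amounts to comparing the sorted prefixes of length \<open>i\<close> entry by entry.\<close>

definition count_above :: "(nat \<Rightarrow> nat) \<Rightarrow> nat \<Rightarrow> nat \<Rightarrow> nat" where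
  "count_above p i c = card {j \<in> {1..i}. c < p j}"

text \<open>Ehresmann's tableau criterion, taken as the definition of the Bruhat order.\<close>

definition perm_le :: "(nat \<Rightarrow> nat) \<Rightarrow> (nat \<Rightarrow> nat) \<Rightarrow> bool" where
  "perm_le p q \<longleftrightarrow> (\<forall>i c. count_above p i c \<le> count_above q i c)"

definition inversions :: "nat \<Rightarrow> (nat \<Rightarrow> nat) \<Rightarrow> (nat \<times> nat) set" where
  "inversions m p = {(i, j). i \<in> {1..m} \<and> j \<in> {1..m} \<and> i < j \<and> p j < p i}"

definition inv_count :: "nat \<Rightarrow> (nat \<Rightarrow> nat) \<Rightarrow> nat" where
  "inv_count m p = card (inversions m p)"

definition swap_values :: "nat \<Rightarrow> (nat \<Rightarrow> nat) \<Rightarrow> nat \<Rightarrow> nat" where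
  "swap_values k p = transpose k (Suc k) \<circ> p"

text \<open>A left ascent: \<open>k\<close> stands before \<open>k + 1\<close> in one-line notation,
  so \<open>swap_values k\<close> adds an inversion.\<close>

definition ascent :: "nat \<Rightarrow> (nat \<Rightarrow> nat) \<Rightarrow> bool" where
  "ascent k p \<longleftrightarrow> inv p k < inv p (Suc k)"

lemma perm_le_refl: "perm_le p p"
  by (simp add: perm_le_def)

lemma perm_le_trans: "perm_le p q \<Longrightarrow> perm_le q u \<Longrightarrow> perm_le p u"
  unfolding perm_le_def by (meson le_trans)

lemma count_above_step:
  "count_above p (Suc i) c = count_above p i c + of_bool (c < p (Suc i))"
proof -
  have "{j \<in> {1..Suc i}. c < p j} =
      {j \<in> {1..i}. c < p j} \<union> (if c < p (Suc i) then {Suc i} else {})"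
    by (auto simp: le_Suc_eq)
  then show ?thesis by (simp add: count_above_def)
qed

lemma permutes_at_0: "p permutes {1..m} \<Longrightarrow> p 0 = (0::nat)"
  by (rule permutes_not_in) auto

lemma perm_le_antisym:
  assumes "p permutes {1..m}" "q permutes {1..m}" "perm_le p q" "perm_le q p"
  shows "p = q"
proof
  fix i
  have eq: "count_above p i c = count_above q i c" for i c
    using assms(3,4) by (simp add: perm_le_def antisym)
  \<comment> \<open>The increment of the count from \<open>i\<close> to \<open>i + 1\<close> reveals
    whether the entry at \<open>i + 1\<close> exceeds \<open>c\<close>.\<close>
  have "c < p (Suc i) \<longleftrightarrow> c < q (Suc i)" for i c
    using eq[of i c] eq[of "Suc i" c] by (auto simp: count_above_step of_bool_def split: if_splits)
  then have "p (Suc i) = q (Suc i)" for i by (metis linorder_neqE_nat less_irrefl)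
  then show "p i = q i" using permutes_at_0 assms(1,2) by (cases i) metis+
qed

lemma inv_pos:
  assumes "p permutes {1..m}" shows "0 < inv p (Suc c)"
  using assms by (metis permutes_at_0 permutes_inverses(1) neq0_conv nat.distinct(1))

lemma inv_neq: "p permutes {1..m} \<Longrightarrow> inv p k \<noteq> inv p (Suc k)"
  by (metis n_not_Suc_n permutes_inverses(1))

text \<open>Lowering the threshold to \<open>c\<close> admits just the value \<open>c + 1\<close>.
  Its position is never 0, so being at most \<open>i\<close> really places it in the prefix.\<close>

lemma count_above_Suc_value:
  assumes "p permutes {1..m}"
  shows "count_above p i c = count_above p i (Suc c) + of_bool (inv p (Suc c) \<le> i)"
proof -
  have "{j \<in> {1..i}. c < p j} =
      {j \<in> {1..i}. Suc c < p j} \<union> (if inv p (Suc c) \<le> i then {inv p (Suc c)} else {})"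
    using inv_pos[OF assms, of c] permutes_inverses[OF assms]
    by (auto simp: Suc_le_eq less_Suc_eq permutes_inv_eq[OF assms])
      (metis Suc_lessI permutes_inverses(2)[OF assms])+
  then show ?thesis
    using permutes_inverses(1)[OF assms] by (simp add: count_above_def)
qed

lemma swap_values_swap_values [simp]: "swap_values k (swap_values k p) = p"
  by (simp add: swap_values_def fun_eq_iff)

section \<open>Exchanging adjacent values: lifting property and change of length\<close>

context
  fixes m k :: nat
  assumes k: "k \<in> {1..m}" "Suc k \<in> {1..m}"
begin

lemma swap_values_permutes:
  "p permutes {1..m} \<Longrightarrow> swap_values k p permutes {1..m}"
  unfolding swap_values_def by (intro permutes_compose permutes_swap_id k)

lemma inv_swap_values:
  assumes "p permutes {1..m}"
  shows "inv (swap_values k p) = inv p \<circ> transpose k (Suc k)"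
proof
  fix x
  show "inv (swap_values k p) x = (inv p \<circ> transpose k (Suc k)) x"
    using permutes_inv_eq[OF swap_values_permutes[OF assms]] permutes_inverses[OF assms]
    by (simp add: swap_values_def)
qed

lemma ascent_swap_values:
  assumes "p permutes {1..m}"
  shows "ascent k (swap_values k p) \<longleftrightarrow> \<not> ascent k p"
  using inv_neq[OF assms, of k] by (auto simp: ascent_def inv_swap_values[OF assms])

lemma count_above_swap_values_other:
  assumes "c \<noteq> k"
  shows "count_above (swap_values k p) i c = count_above p i c"
proof -
  have "c < transpose k (Suc k) x \<longleftrightarrow> c < x" for x
    using assms by (auto simp: transpose_def)
  then show ?thesis by (simp add: count_above_def swap_values_def)
qed

lemma count_above_swap_values:
  assumes "p permutes {1..m}"
  shows "count_above (swap_values k p) i k =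
    count_above p i (Suc k) + of_bool (inv p k \<le> i)"
  using count_above_Suc_value[OF swap_values_permutes[OF assms], of i k]
  by (simp add: inv_swap_values[OF assms] count_above_swap_values_other)

text \<open>The comparisons at thresholds \<open>k + 1\<close>, \<open>k\<close> and
  \<open>k - 1\<close>, all expressed from the count at \<open>k + 1\<close>, which
  \<open>swap_values k\<close> leaves alone. Lifting thus becomes a finite check on which positions
  of \<open>k\<close> and \<open>k + 1\<close> lie in the prefix.\<close>

lemma perm_le_values:
  assumes "p permutes {1..m}" "q permutes {1..m}" "perm_le p q"
  shows "count_above p i (Suc k) \<le> count_above q i (Suc k)"
    and "count_above p i (Suc k) + of_bool (inv p (Suc k) \<le> i) \<le>
      count_above q i (Suc k) + of_bool (inv q (Suc k) \<le> i)"
    and "count_above p i (Suc k) + of_bool (inv p (Suc k) \<le> i) + of_bool (inv p k \<le> i) \<le>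
      count_above q i (Suc k) + of_bool (inv q (Suc k) \<le> i) + of_bool (inv q k \<le> i)"
proof -
  obtain k' where k': "k = Suc k'" using k by (cases k) auto
  have le: "count_above p i c \<le> count_above q i c" for c
    using assms(3) by (simp add: perm_le_def)
  note count = count_above_Suc_value[OF assms(1), of i] count_above_Suc_value[OF assms(2), of i]
  show "count_above p i (Suc k) \<le> count_above q i (Suc k)" by (rule le)
  show "count_above p i (Suc k) + of_bool (inv p (Suc k) \<le> i) \<le>
      count_above q i (Suc k) + of_bool (inv q (Suc k) \<le> i)"
    using le[of k] count[of k] by simp
  show "count_above p i (Suc k) + of_bool (inv p (Suc k) \<le> i) + of_bool (inv p k \<le> i) \<le>
      count_above q i (Suc k) + of_bool (inv q (Suc k) \<le> i) + of_bool (inv q k \<le> i)"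
    using le[of k'] count[of k'] count[of k] k' by simp
qed

lemma perm_le_I:
  assumes "\<And>c i. c \<noteq> k \<Longrightarrow> count_above p i c \<le> count_above q i c"
    and "\<And>i. count_above p i k \<le> count_above q i k"
  shows "perm_le p q"
  unfolding perm_le_def using assms by metis

lemma ascent_le: "p permutes {1..m} \<Longrightarrow> ascent k p \<Longrightarrow> perm_le p (swap_values k p)"
  by (rule perm_le_I)
    (auto simp: count_above_swap_values_other count_above_swap_values ascent_def
      count_above_Suc_value[of _ _ _ k])

text \<open>Only the count at threshold \<open>k\<close> changes. For an ascent, a prefix that
  contains \<open>k + 1\<close> also contains \<open>k\<close>; with this,
  \<open>perm_le_values\<close> settles each distribution of the four positions.\<close>

lemma
  assumes "p permutes {1..m}" "q permutes {1..m}" "perm_le p q"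
  shows lift_right: "ascent k p \<Longrightarrow> \<not> ascent k q \<Longrightarrow> perm_le p (swap_values k q)"
    and lift_left: "ascent k p \<Longrightarrow> \<not> ascent k q \<Longrightarrow> perm_le (swap_values k p) q"
    and lift_both_up: "ascent k p \<Longrightarrow> ascent k q \<Longrightarrow> perm_le (swap_values k p) (swap_values k q)"
    and lift_both_down:
      "\<not> ascent k p \<Longrightarrow> \<not> ascent k q \<Longrightarrow> perm_le (swap_values k p) (swap_values k q)"
proof -
  note le = perm_le_values[OF assms]
  have other: "count_above p i c \<le> count_above q i c" for i c
    using assms(3) by (simp add: perm_le_def)
  note count = count_above_swap_values[OF assms(1)] count_above_swap_values[OF assms(2)]
    count_above_Suc_value[OF assms(1), of _ k] count_above_Suc_value[OF assms(2), of _ k]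
  show "perm_le p (swap_values k q)" if "ascent k p" "\<not> ascent k q"
  proof (rule perm_le_I)
    show "count_above p i k \<le> count_above (swap_values k q) i k" for i
      using that le[of i] unfolding count ascent_def
      by (cases "inv p k \<le> i"; cases "inv p (Suc k) \<le> i"; cases "inv q k \<le> i";
          cases "inv q (Suc k) \<le> i") simp_all
  qed (use other in \<open>simp add: count_above_swap_values_other\<close>)
  show "perm_le (swap_values k p) q" if "ascent k p" "\<not> ascent k q"
  proof (rule perm_le_I)
    show "count_above (swap_values k p) i k \<le> count_above q i k" for i
      using that le[of i] unfolding count ascent_def
      by (cases "inv p k \<le> i"; cases "inv p (Suc k) \<le> i"; cases "inv q k \<le> i";
          cases "inv q (Suc k) \<le> i") simp_all
  qed (use other in \<open>simp add: count_above_swap_values_other\<close>)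
  show "perm_le (swap_values k p) (swap_values k q)" if "ascent k p" "ascent k q"
  proof (rule perm_le_I)
    show "count_above (swap_values k p) i k \<le> count_above (swap_values k q) i k" for i
      using that le[of i] unfolding count ascent_def
      by (cases "inv p k \<le> i"; cases "inv p (Suc k) \<le> i"; cases "inv q k \<le> i";
          cases "inv q (Suc k) \<le> i") simp_all
  qed (use other in \<open>simp add: count_above_swap_values_other\<close>)
  show "perm_le (swap_values k p) (swap_values k q)" if "\<not> ascent k p" "\<not> ascent k q"
  proof (rule perm_le_I)
    show "count_above (swap_values k p) i k \<le> count_above (swap_values k q) i k" for i
      using that le[of i] unfolding count ascent_def
      by (cases "inv p k \<le> i"; cases "inv p (Suc k) \<le> i"; cases "inv q k \<le> i";
          cases "inv q (Suc k) \<le> i") simp_all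
  qed (use other in \<open>simp add: count_above_swap_values_other\<close>)
qed

text \<open>Exchanging consecutive values alters the comparison of two entries only if these are
  \<open>k\<close> and \<open>k + 1\<close>, so a single inversion disappears.\<close>

lemma inversions_descent:
  assumes "p permutes {1..m}" "\<not> ascent k p"
  shows "inversions m p = insert (inv p (Suc k), inv p k) (inversions m (swap_values k p))"
    and "(inv p (Suc k), inv p k) \<notin> inversions m (swap_values k p)"
proof -
  let ?u = "inv p (Suc k)" and ?w = "inv p k"
  have less: "?u < ?w" using assms inv_neq[OF assms(1), of k] by (auto simp: ascent_def)
  have p: "p ?u = Suc k" "p ?w = k" "?u \<in> {1..m}" "?w \<in> {1..m}"
    using permutes_inverses(1)[OF assms(1)] permutes_in_image[OF permutes_inv[OF assms(1)]] k
    by auto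
  have pk: "p i = k \<longleftrightarrow> i = ?w" "p i = Suc k \<longleftrightarrow> i = ?u" for i
    using permutes_inverses[OF assms(1)] by metis+
  show "(?u, ?w) \<notin> inversions m (swap_values k p)"
    by (simp add: inversions_def swap_values_def p)
  have "transpose k (Suc k) (p j) < transpose k (Suc k) (p i) \<longleftrightarrow> p j < p i"
    if "i < j" "(i, j) \<noteq> (?u, ?w)" for i j
  proof -
    have "\<not> (p i = Suc k \<and> p j = k)" "\<not> (p i = k \<and> p j = Suc k)"
      using that less pk by auto
    then show ?thesis by (auto simp: transpose_def)
  qed
  then have "(i, j) \<in> inversions m p \<longleftrightarrow>
      (i, j) = (?u, ?w) \<or> (i, j) \<in> inversions m (swap_values k p)" for i j
    using p less by (cases "(i, j) = (?u, ?w)") (auto simp: inversions_def swap_values_def)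
  then show "inversions m p = insert (?u, ?w) (inversions m (swap_values k p))"
    by auto
qed

lemma inv_count_descent:
  assumes "p permutes {1..m}" "\<not> ascent k p"
  shows "inv_count m p = Suc (inv_count m (swap_values k p))"
proof -
  have "finite (inversions m q)" for q
    by (rule finite_subset[of _ "{1..m} \<times> {1..m}"]) (auto simp: inversions_def)
  then show ?thesis
    unfolding inv_count_def inversions_descent(1)[OF assms]
    using inversions_descent(2)[OF assms] by simp
qed

end

section \<open>Existence of descents and monotonicity of the length\<close>

lemma no_descent_id:
  assumes p: "p permutes {1..m}" and asc: "\<And>k. k \<in> {1..m} \<Longrightarrow> Suc k \<in> {1..m} \<Longrightarrow> ascent k p"
  shows "p = id"
proof -
  \<comment> \<open>Without descents \<open>inv p\<close> is strictly increasing on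
    \<open>{1..m}\<close>, hence nowhere below the identity, and a permutation with this property is
    the identity.\<close>
  have "k \<le> inv p k" if "k \<le> m" for k
    using that
  proof (induction k)
    case (Suc k)
    show ?case
    proof (cases "k = 0")
      case True
      then show ?thesis using inv_pos[OF p, of 0] by simp
    next
      case False
      then show ?thesis using asc[of k] Suc by (simp add: ascent_def)
    qed
  qed simp
  then have "inv p = id"
    by (intro permutes_natset_ge[OF permutes_inv[OF p]]) auto
  then show ?thesis
    by (metis p permutes_inv_inv inv_id)
qed

lemma perm_le_id:
  assumes "p permutes {1..m}" "perm_le p id"
  shows "p = id"
proof (rule permutes_natset_le[OF assms(1)], rule ballI)
  fix i assume i: "i \<in> {1..m}"
  have "count_above p i i \<le> count_above id i i" using assms(2) by (simp add: perm_le_def)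
  also have "\<dots> = 0" by (simp add: count_above_def)
  finally have "{j \<in> {1..i}. i < p j} = {}" by (simp add: count_above_def)
  then have "\<not> i < p i" using i by fastforce
  then show "p i \<le> i" by simp
qed

text \<open>As the identity is minimal, \<open>q\<close> is not the identity. This drives each of
  the later inductions on length.\<close>

lemma descent_exists:
  assumes "p permutes {1..m}" "q permutes {1..m}" "perm_le p q" "p \<noteq> q"
  obtains k where "k \<in> {1..m}" "Suc k \<in> {1..m}" "\<not> ascent k q"
  using no_descent_id[OF assms(2)] perm_le_id[OF assms(1)] assms by metis

text \<open>Removing a descent of \<open>q\<close>, lifting puts \<open>p\<close>, or
  \<open>swap_values k p\<close> if \<open>k\<close> is a descent of \<open>p\<close> as well, below
  the shorter \<open>swap_values k q\<close>.\<close>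

lemma inv_count_mono:
  assumes "p permutes {1..m}" "q permutes {1..m}" "perm_le p q"
  shows "inv_count m p \<le> inv_count m q"
  using assms
proof (induction "inv_count m q" arbitrary: p q rule: less_induct)
  case less
  show ?case
  proof (cases "p = q")
    case False
    obtain k where k: "k \<in> {1..m}" "Suc k \<in> {1..m}" "\<not> ascent k q"
      using descent_exists[OF less.prems False] .
    note perm = swap_values_permutes[OF k(1,2)]
    have q: "inv_count m q = Suc (inv_count m (swap_values k q))"
      using inv_count_descent less.prems k by blast
    show ?thesis
    proof (cases "ascent k p")
      case True
      then have "inv_count m p \<le> inv_count m (swap_values k q)"
        using less.hyps[of "swap_values k q" p] lift_right[OF k(1,2) less.prems] k(3) perm
          less.prems q by simp
      then show ?thesis using q by simp
    next
      case False
      then have "inv_count m (swap_values k p) \<le> inv_count m (swap_values k q)"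
        using less.hyps[of "swap_values k q" "swap_values k p"]
          lift_both_down[OF k(1,2) less.prems] k(3) perm less.prems q by simp
      then show ?thesis using q inv_count_descent[OF k(1,2) less.prems(1) False] by simp
    qed
  qed simp
qed

section \<open>The tableau criterion\<close>

definition perm_step :: "nat \<Rightarrow> (nat \<Rightarrow> nat) rel" where
  "perm_step m = {(p, p \<circ> transpose i j) | p i j.
     p permutes {1..m} \<and> i \<in> {1..m} \<and> j \<in> {1..m} \<and> i < j \<and> p i < p j}"

lemma perm_stepI:
  "p permutes {1..m} \<Longrightarrow> i \<in> {1..m} \<Longrightarrow> j \<in> {1..m} \<Longrightarrow> i < j \<Longrightarrow> p i < p j \<Longrightarrow>
    (p, p \<circ> transpose i j) \<in> perm_step m"
  unfolding perm_step_def by blast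

lemma perm_stepE:
  assumes "(p, q) \<in> perm_step m"
  obtains i j where "q = p \<circ> transpose i j" "p permutes {1..m}"
    "i \<in> {1..m}" "j \<in> {1..m}" "i < j" "p i < p j"
  using assms unfolding perm_step_def by blast

lemma perm_step_permutes:
  assumes "(p, q) \<in> perm_step m"
  shows "p permutes {1..m}" "q permutes {1..m}"
  using assms by (metis perm_stepE permutes_compose permutes_swap_id)+

lemma perm_step_le:
  assumes "(p, q) \<in> perm_step m"
  shows "perm_le p q"
proof -
  obtain i j where q: "q = p \<circ> transpose i j" and ij: "i \<in> {1..m}" "i < j" "p i < p j"
    using assms by (rule perm_stepE)
  show ?thesis
    unfolding perm_le_def count_above_def
  proof (intro allI)
    fix h c
    \<comment> \<open>If the prefix contains \<open>j\<close>, it contains both exchanged positions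
      and \<open>transpose i j\<close> is an injection; otherwise at most position \<open>i\<close>
      matters, and the entry there grows.\<close>
    show "card {x \<in> {1..h}. c < p x} \<le> card {x \<in> {1..h}. c < q x}"
    proof (cases "j \<le> h")
      case True
      then show ?thesis
        using ij by (intro card_inj_on_le[where f = "transpose i j"]) (auto simp: q transpose_def)
    next
      case False
      then show ?thesis
        using ij by (intro card_mono) (auto simp: q transpose_def)
    qed
  qed
qed

lemma ascent_step:
  assumes k: "k \<in> {1..m}" "Suc k \<in> {1..m}" and p: "p permutes {1..m}" and "ascent k p"
  shows "(p, swap_values k p) \<in> perm_step m"
proof -
  have "swap_values k p = p \<circ> transpose (inv p k) (inv p (Suc k))"
  proof
    fix x
    show "swap_values k p x = (p \<circ> transpose (inv p k) (inv p (Suc k))) x"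
      using permutes_inverses[OF p] by (auto simp: swap_values_def transpose_def) metis+
  qed
  moreover have "inv p k \<in> {1..m}" "inv p (Suc k) \<in> {1..m}"
    using permutes_in_image[OF permutes_inv[OF p]] k by blast+
  ultimately show ?thesis
    using perm_stepI[OF p, of "inv p k" "inv p (Suc k)"] assms(4) permutes_inverses(1)[OF p]
    by (simp add: ascent_def)
qed

text \<open>The inequality \<open>p i < p j\<close> survives the exchange unless the entries are
  \<open>k\<close> and \<open>k + 1\<close>, and that step leads to
  \<open>swap_values k p\<close>.\<close>

lemma perm_step_swap_values:
  assumes k: "k \<in> {1..m}" "Suc k \<in> {1..m}" and "(p, q) \<in> perm_step m" "q \<noteq> swap_values k p"
  shows "(swap_values k p, swap_values k q) \<in> perm_step m"
proof -
  obtain i j where q: "q = p \<circ> transpose i j" and p: "p permutes {1..m}"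
    and ij: "i \<in> {1..m}" "j \<in> {1..m}" "i < j" "p i < p j"
    using assms(3) by (rule perm_stepE)
  have "\<not> (p i = k \<and> p j = Suc k)"
  proof
    assume "p i = k \<and> p j = Suc k"
    then have "q = swap_values k p"
      using permutes_inj[OF p]
      unfolding q swap_values_def fun_eq_iff o_def transpose_def inj_def by metis
    then show False using assms by simp
  qed
  then have "swap_values k p i < swap_values k p j"
    using ij by (auto simp: swap_values_def transpose_def)
  moreover have "swap_values k q = swap_values k p \<circ> transpose i j"
    by (simp add: q swap_values_def comp_assoc)
  ultimately show ?thesis
    using perm_stepI[OF swap_values_permutes[OF k p] ij(1-3)] by simp
qed

lemma perm_steps_up:
  assumes k: "k \<in> {1..m}" "Suc k \<in> {1..m}" and "(p, q) \<in> (perm_step m)\<^sup>*"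
  defines "up \<equiv> (\<lambda>p. if ascent k p then swap_values k p else p)"
  shows "(up p, up q) \<in> (perm_step m)\<^sup>*"
  using assms(3)
proof induction
  case (step q u)
  have perm: "q permutes {1..m}" "u permutes {1..m}" using perm_step_permutes[OF step(2)] by auto
  have "(up q, up u) \<in> (perm_step m)\<^sup>*"
  proof (cases "ascent k q \<and> u \<noteq> swap_values k q")
    case True
    then have su: "(swap_values k q, swap_values k u) \<in> perm_step m"
      using perm_step_swap_values[OF k step(2)] by blast
    show ?thesis
    proof (cases "ascent k u")
      case False
      have "(swap_values k u, u) \<in> perm_step m"
        using ascent_step[OF k swap_values_permutes[OF k perm(2)]] False
          ascent_swap_values[OF k perm(2)] by simp
      then show ?thesis using True False su by (auto simp: up_def)
    qed (use True su in \<open>auto simp: up_def\<close>)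
  next
    case False
    show ?thesis
    proof (cases "ascent k q")
      case True
      then have "up u = u" "up q = u"
        using False ascent_swap_values[OF k perm(1)] by (auto simp: up_def)
      then show ?thesis by simp
    next
      case False
      then have "(up q, u) \<in> (perm_step m)\<^sup>*" using step by (auto simp: up_def)
      moreover have "(u, up u) \<in> (perm_step m)\<^sup>*"
        using ascent_step[OF k perm(2)] by (auto simp: up_def)
      ultimately show ?thesis by simp
    qed
  qed
  then show ?case using step by simp
qed simp

text \<open>Induction on the length of \<open>q\<close> through a descent \<open>k\<close>. If
  \<open>k\<close> is an ascent of \<open>p\<close>, a chain to \<open>swap_values k q\<close> is
  extended by one step; otherwise a chain between the two shortened permutations is raised by
  \<open>perm_steps_up\<close>.\<close>

lemma perm_le_imp_steps:
  assumes "p permutes {1..m}" "q permutes {1..m}" "perm_le p q"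
  shows "(p, q) \<in> (perm_step m)\<^sup>*"
  using assms
proof (induction "inv_count m q" arbitrary: p q rule: less_induct)
  case less
  show ?case
  proof (cases "p = q")
    case False
    obtain k where k: "k \<in> {1..m}" "Suc k \<in> {1..m}" "\<not> ascent k q"
      using descent_exists[OF less.prems False] .
    note perm = swap_values_permutes[OF k(1,2)]
    note asc = ascent_swap_values[OF k(1,2)]
    have q: "inv_count m (swap_values k q) < inv_count m q"
      using inv_count_descent[OF k(1,2) less.prems(2)] k(3) by simp
    have sq: "(swap_values k q, q) \<in> perm_step m"
      using ascent_step[OF k(1,2) perm[OF less.prems(2)]] asc[OF less.prems(2)] k(3) by simp
    show ?thesis
    proof (cases "ascent k p")
      case True
      then have "(p, swap_values k q) \<in> (perm_step m)\<^sup>*"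
        using less.hyps[OF q] lift_right[OF k(1,2) less.prems] k(3) perm less.prems by simp
      then show ?thesis using sq by simp
    next
      case False
      then have "(swap_values k p, swap_values k q) \<in> (perm_step m)\<^sup>*"
        using less.hyps[OF q] lift_both_down[OF k(1,2) less.prems] k(3) perm less.prems by simp
      then show ?thesis
        using perm_steps_up[OF k(1,2), of "swap_values k p" "swap_values k q"] perm less.prems
          asc[OF less.prems(1)] asc[OF less.prems(2)] k(3) False by simp
    qed
  qed simp
qed

lemma perm_steps_imp_le: "(p, q) \<in> (perm_step m)\<^sup>* \<Longrightarrow> perm_le p q"
  by (induction rule: rtrancl_induct) (auto intro: perm_le_refl perm_le_trans perm_step_le)

section \<open>Permutations increasing along a relation\<close>

text \<open>For a strict order \<open>R\<close> on positions these are its linear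
  extensions.\<close>

definition increasing_perms :: "nat \<Rightarrow> nat rel \<Rightarrow> (nat \<Rightarrow> nat) set" where
  "increasing_perms m R = {p. p permutes {1..m} \<and> (\<forall>i j. (i, j) \<in> R \<longrightarrow> p i < p j)}"

definition increasing_order :: "nat \<Rightarrow> nat rel \<Rightarrow> (nat \<Rightarrow> nat) rel" where
  "increasing_order m R =
    {(p, q). p \<in> increasing_perms m R \<and> q \<in> increasing_perms m R \<and> perm_le p q}"

lemma increasing_perms_permutes: "p \<in> increasing_perms m R \<Longrightarrow> p permutes {1..m}"
  by (simp add: increasing_perms_def)

lemma finite_increasing_perms: "finite (increasing_perms m R)"
  by (rule finite_subset[OF _ finite_permutations[of "{1..m}"]])
    (auto simp: increasing_perms_def)

lemma partial_order_increasing: "partial_order_on (increasing_perms m R) (increasing_order m R)"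
  unfolding partial_order_on_def preorder_on_def refl_on_def antisym_def trans_def
    increasing_order_def
  by (auto intro: perm_le_refl perm_le_trans perm_le_antisym increasing_perms_permutes)

text \<open>A pair \<open>(i, j)\<close> means that the element at \<open>j\<close> is strictly
  below the one at \<open>i\<close>. \<open>convex\<close> records consistency: the positions of the
  elements above the one at \<open>j\<close> have no gaps up to \<open>j\<close>.\<close>

context
  fixes m :: nat and R :: "nat rel"
  assumes R: "\<And>i j. (i, j) \<in> R \<Longrightarrow> 1 \<le> i \<and> i < j"
    and convex: "\<And>i j h. (i, j) \<in> R \<Longrightarrow> i \<le> h \<Longrightarrow> h < j \<Longrightarrow> (h, j) \<in> R"
begin

text \<open>In a descent \<open>k + 1\<close> stands before \<open>k\<close>, whereas pairs of
  \<open>R\<close> run from left to right, so no pair carries the values \<open>k\<close>,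
  \<open>k + 1\<close>.\<close>

lemma increasing_perms_descent:
  assumes k: "k \<in> {1..m}" "Suc k \<in> {1..m}"
    and p: "p \<in> increasing_perms m R" and "\<not> ascent k p"
  shows "swap_values k p \<in> increasing_perms m R"
proof -
  note perm = increasing_perms_permutes[OF p]
  have "swap_values k p i < swap_values k p j" if "(i, j) \<in> R" for i j
  proof -
    have "\<not> (p i = k \<and> p j = Suc k)"
      using R[OF that] assms(4) permutes_inv_eq[OF perm] by (metis ascent_def)
    moreover have "p i < p j" using p that by (simp add: increasing_perms_def)
    ultimately show ?thesis by (auto simp: swap_values_def transpose_def)
  qed
  then show ?thesis
    using swap_values_permutes[OF k perm] by (simp add: increasing_perms_def)
qed

text \<open>A pair \<open>(u, w)\<close> of \<open>R\<close> with values \<open>k\<close> and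
  \<open>k + 1\<close> blocks \<open>y\<close>, so the counts of \<open>y\<close> and
  \<open>swap_values k y\<close> differ only at threshold \<open>k\<close> for prefixes containing
  \<open>u\<close> but not \<open>w\<close>. There the comparison is taken from the prefix before
  \<open>u\<close> or from the one ending at \<open>w\<close>, where both counts agree.\<close>

lemma perm_le_blocked:
  assumes k: "k \<in> {1..m}" "Suc k \<in> {1..m}"
    and y: "y \<in> increasing_perms m R" "swap_values k y \<notin> increasing_perms m R"
    and z: "z \<in> increasing_perms m R" "perm_le z (swap_values k y)"
  shows "perm_le z y"
proof -
  note perm = increasing_perms_permutes[OF y(1)]
  have y_less: "y i < y j" and z_less: "z i < z j" if "(i, j) \<in> R" for i j
    using y(1) z(1) that by (auto simp: increasing_perms_def)
  obtain u w where uw: "(u, w) \<in> R" "\<not> swap_values k y u < swap_values k y w"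
    using y(2) swap_values_permutes[OF k perm] by (auto simp: increasing_perms_def)
  then have yuw: "y u = k" "y w = Suc k"
    using y_less[OF uw(1)] by (auto simp: swap_values_def transpose_def split: if_splits)
  then have inv: "inv y k = u" "inv y (Suc k) = w"
    by (simp_all add: permutes_inv_eq[OF perm])
  have le: "count_above z i c \<le> count_above (swap_values k y) i c" for i c
    using z(2) by (simp add: perm_le_def)
  have swap: "count_above (swap_values k y) i k = count_above y i (Suc k) + of_bool (u \<le> i)" for i
    using count_above_swap_values[OF k perm] inv by simp
  have count: "count_above y i k = count_above y i (Suc k) + of_bool (w \<le> i)" for i
    using count_above_Suc_value[OF perm, of i k] inv by simp
  have u_less_w: "1 \<le> u" "u < w" using R[OF uw(1)] by auto
  show ?thesis
  proof (rule perm_le_I[OF k])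
    show "count_above z i c \<le> count_above y i c" if "c \<noteq> k" for c i
      using le[of i c] count_above_swap_values_other[OF k that] by simp
    show "count_above z i k \<le> count_above y i k" for i
    proof (cases "u \<le> i \<and> i < w")
      case False
      then show ?thesis using le[of i k] swap[of i] count[of i] u_less_w by auto
    next
      case True
      show ?thesis
      proof (cases "\<exists>j\<in>{u..i}. k < z j")
        case False
        \<comment> \<open>Without entries above \<open>k\<close> from \<open>u\<close> to
          \<open>i\<close>, the count of \<open>z\<close> has not grown since
          \<open>u - 1\<close>.\<close>
        then have "{x \<in> {1..i}. k < z x} \<subseteq> {x \<in> {1..u - 1}. k < z x}" by force
        then have "count_above z i k \<le> count_above z (u - 1) k"
          unfolding count_above_def by (intro card_mono) auto
        also have "\<dots> \<le> count_above y (u - 1) k"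
        proof -
          have "\<not> u \<le> u - 1" "\<not> w \<le> u - 1" using u_less_w by auto
          then show ?thesis using le[of "u - 1" k] swap[of "u - 1"] count[of "u - 1"] by simp
        qed
        also have "\<dots> \<le> count_above y i k"
          using True unfolding count_above_def by (intro card_mono) auto
        finally show ?thesis .
      next
        case jex: True
        then obtain j where j: "u \<le> j" "j \<le> i" "k < z j" by auto
        \<comment> \<open>By convexity \<open>(j, w)\<close> is in \<open>R\<close>, so the count of
          \<open>z\<close> grows by at least one from \<open>i\<close> to \<open>w\<close>.\<close>
        then have "k < z w" using z_less[OF convex[OF uw(1), of j]] True by simp
        then have "insert w {x \<in> {1..i}. k < z x} \<subseteq> {x \<in> {1..w}. k < z x}"
          using True u_less_w by auto
        then have "card (insert w {x \<in> {1..i}. k < z x}) \<le> count_above z w k"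
          unfolding count_above_def by (intro card_mono) auto
        then have "Suc (count_above z i k) \<le> count_above z w k"
          using True by (simp add: count_above_def)
        also have "\<dots> \<le> count_above y w k"
          using le[of w k] swap[of w] count[of w] u_less_w by simp
        also have "\<dots> \<le> card (insert w {x \<in> {1..i}. k < y x})"
        proof -
          \<comment> \<open>The count of \<open>y\<close> grows by at most one: by convexity the
            entries strictly between \<open>i\<close> and \<open>w\<close> are less than
            \<open>y w = k + 1\<close>.\<close>
          have "x = w \<or> x \<le> i" if "x \<le> w" "k < y x" for x
            using y_less[OF convex[OF uw(1)], of x] yuw that True by fastforce
          then have "{x \<in> {1..w}. k < y x} \<subseteq> insert w {x \<in> {1..i}. k < y x}"
            by auto
          then show ?thesis unfolding count_above_def by (intro card_mono) auto
        qed
        also have "\<dots> \<le> Suc (count_above y i k)"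
          by (simp add: count_above_def card_insert_le_m1 card_insert_if)
        finally show ?thesis by simp
      qed
    qed
  qed
qed

lemma lifting_poset_increasing:
  assumes k: "k \<in> {1..m}" "Suc k \<in> {1..m}"
  defines "D \<equiv> increasing_perms m R"
  shows "lifting_poset D (increasing_order m R)
    {p \<in> D. ascent k p \<and> swap_values k p \<in> D} {p \<in> D. \<not> ascent k p}
    {p \<in> D. ascent k p \<and> swap_values k p \<notin> D} (swap_values k)"
proof -
  have perm: "p permutes {1..m}" if "p \<in> D" for p
    using that increasing_perms_permutes by (simp add: D_def)
  have down: "swap_values k p \<in> D" if "p \<in> D" "\<not> ascent k p" for p
    using increasing_perms_descent[OF k] that unfolding D_def by blast
  have rel: "(p, q) \<in> increasing_order m R \<longleftrightarrow> p \<in> D \<and> q \<in> D \<and> perm_le p q" for p q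
    by (simp add: increasing_order_def D_def)
  note asc = ascent_swap_values[OF k]
  show ?thesis
  proof
    show "finite D" "partial_order_on D (increasing_order m R)"
      unfolding D_def by (rule finite_increasing_perms partial_order_increasing)+
  next
    fix p q assume pq: "(p, q) \<in> increasing_order m R"
    then have pq': "p \<in> D" "q \<in> D" "perm_le p q" "p permutes {1..m}" "q permutes {1..m}"
      using rel perm by auto
    note lift = lift_right[OF k pq'(4,5,3)] lift_left[OF k pq'(4,5,3)]
      lift_both_up[OF k pq'(4,5,3)]
    show "(p, swap_values k q) \<in> increasing_order m R"
      if "p \<in> {p \<in> D. ascent k p \<and> swap_values k p \<in> D} \<union>
          {p \<in> D. ascent k p \<and> swap_values k p \<notin> D}" "q \<in> {p \<in> D. \<not> ascent k p}"
      using that lift(1) down pq' by (auto simp: rel)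
    show "(swap_values k p, q) \<in> increasing_order m R"
      if p: "p \<in> {p \<in> D. ascent k p \<and> swap_values k p \<in> D}"
        and q: "q \<in> {p \<in> D. \<not> ascent k p} \<union> {p \<in> D. ascent k p \<and> swap_values k p \<notin> D}"
    proof (cases "ascent k q")
      case True
      \<comment> \<open>Lifting only places \<open>swap_values k p\<close> below
        \<open>swap_values k q\<close>, which is outside \<open>D\<close>;
        \<open>perm_le_blocked\<close> descends from there to \<open>q\<close>.\<close>
      then have "perm_le (swap_values k p) q"
        using perm_le_blocked[OF k] lift(3) p q
        unfolding D_def by blast
      then show ?thesis using p pq' by (simp add: rel)
    next
      case False
      then show ?thesis using lift(2) p pq' by (auto simp: rel)
    qed
  qed (use asc perm down ascent_le[OF k] in \<open>auto simp: rel\<close>)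
qed

text \<open>Induction on the length of \<open>b\<close>: a descent of \<open>b\<close> provides a
  \<open>lifting_poset\<close>, and the right-hand side obeys the same recursion for each type of
  \<open>a\<close>. Only parity matters, so the exponent is a sum rather than a truncated
  difference.\<close>

lemma moebius_increasing_perms:
  assumes "(a, b) \<in> increasing_order m R"
  shows "moebius (increasing_perms m R) (increasing_order m R) a b =
    (if \<forall>c. c permutes {1..m} \<longrightarrow> perm_le a c \<longrightarrow> perm_le c b \<longrightarrow> c \<in> increasing_perms m R
     then (-1) ^ (inv_count m a + inv_count m b) else 0)"
  using assms
proof (induction "inv_count m b" arbitrary: a b rule: less_induct)
  case less
  let ?D = "increasing_perms m R" and ?r = "increasing_order m R"
  define full where
    "full a b \<longleftrightarrow> (\<forall>c. c permutes {1..m} \<longrightarrow> perm_le a c \<longrightarrow> perm_le c b \<longrightarrow> c \<in> ?D)" for a b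
  have rel: "(p, q) \<in> ?r \<longleftrightarrow> p \<in> ?D \<and> q \<in> ?D \<and> perm_le p q" for p q
    by (simp add: increasing_order_def)
  have ab: "a \<in> ?D" "b \<in> ?D" "perm_le a b" using less.prems by (auto simp: rel)
  have perm: "p permutes {1..m}" if "p \<in> ?D" for p
    using that by (rule increasing_perms_permutes)
  note IH = less.hyps[folded full_def]
  have "moebius ?D ?r a b = (if full a b then (-1) ^ (inv_count m a + inv_count m b) else 0)"
  proof (cases "a = b")
    case True
    have "full a b"
      unfolding full_def True using perm_le_antisym perm ab by metis
    then show ?thesis
      using moebius_refl[OF finite_increasing_perms partial_order_increasing ab(1)]
      by (simp add: True flip: mult_2)
  next
    case False
    obtain k where k: "k \<in> {1..m}" "Suc k \<in> {1..m}" "\<not> ascent k b"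
      using descent_exists[OF perm[OF ab(1)] perm[OF ab(2)] ab(3) False] .
    define s where "s = swap_values k"
    define U where "U = {p \<in> ?D. ascent k p \<and> s p \<in> ?D}"
    define L where "L = {p \<in> ?D. \<not> ascent k p}"
    define F where "F = {p \<in> ?D. ascent k p \<and> s p \<notin> ?D}"
    interpret lifting_poset ?D ?r U L F s
      unfolding U_def L_def F_def s_def by (rule lifting_poset_increasing[OF k(1,2)])
    have s_perm: "s p permutes {1..m}" if "p permutes {1..m}" for p
      using swap_values_permutes[OF k(1,2)] that by (simp add: s_def)
    have ss [simp]: "s (s p) = p" for p by (simp add: s_def)
    have asc: "ascent k (s p) \<longleftrightarrow> \<not> ascent k p" if "p permutes {1..m}" for p
      using ascent_swap_values[OF k(1,2) that] by (simp add: s_def)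
    note lift = lift_right[OF k(1,2), folded s_def] lift_left[OF k(1,2), folded s_def]
      lift_both_up[OF k(1,2), folded s_def] lift_both_down[OF k(1,2), folded s_def]
    have down: "s p \<in> ?D" if "p \<in> L" for p
      using s_down[OF that] by (simp add: U_def)
    have bL: "b \<in> L" using ab k(3) by (simp add: L_def)
    have sb: "s b \<in> ?D" "perm_le (s b) b" "ascent k (s b)"
      using down_le[OF bL] asc perm ab(2) k(3) by (auto simp: rel)
    have count_b: "inv_count m b = Suc (inv_count m (s b))"
      using inv_count_descent[OF k(1,2) perm[OF ab(2)] k(3)] by (simp add: s_def)
    \<comment> \<open>A bad \<open>c\<close> is not below \<open>s b\<close>, so lifting shows that
      it is a descent with \<open>s c\<close> between \<open>x\<close> and \<open>s b\<close>. Hence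
      \<open>s c\<close> is increasing and blocked, with Moebius value 0, while the induction
      hypothesis gives a sign.\<close>
    have full_up: "full x b" if x: "x \<in> U" "full x (s b)" for x
      unfolding full_def
    proof (intro allI impI, rule ccontr)
      fix c assume c: "c permutes {1..m}" "perm_le x c" "perm_le c b" "c \<notin> ?D"
      have xD: "x \<in> ?D" "ascent k x" using x by (auto simp: U_def)
      have "\<not> perm_le c (s b)" using x(2) c by (auto simp: full_def)
      then have nasc: "\<not> ascent k c" using lift(1)[OF c(1) perm[OF ab(2)] c(3)] k(3) by blast
      then have sc: "perm_le (s c) (s b)" "perm_le x (s c)"
        using lift(4)[OF c(1) perm[OF ab(2)] c(3)] lift(1)[OF perm[OF xD(1)] c(1,2)] xD k(3)
        by auto
      then have "s c \<in> ?D" using x(2) s_perm[OF c(1)] by (simp add: full_def)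
      then have scF: "s c \<in> F" using asc[OF c(1)] nasc c(4) by (simp add: F_def)
      have xsc: "(x, s c) \<in> ?r" using \<open>s c \<in> ?D\<close> xD sc by (simp add: rel)
      then have zero: "moebius ?D ?r x (s c) = 0"
        using mu_from_up[OF _ x(1)] scF \<open>s c \<in> ?D\<close> by blast
      have "inv_count m (s c) < inv_count m b"
        using inv_count_mono[OF s_perm[OF c(1)] perm[OF sb(1)] sc(1)] count_b by simp
      moreover have "full x (s c)"
        using x(2) perm_le_trans[OF _ sc(1)] by (auto simp: full_def)
      ultimately show False using IH[OF _ xsc] zero by simp
    qed
    have full_mono: "full x' y'" if "full x y" "perm_le x x'" "perm_le y' y" for x y x' y'
      using that perm_le_trans unfolding full_def by blast
    consider "a \<in> F" | "a \<in> U" | "a \<in> L" using ab cover by blast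
    then show ?thesis
    proof cases
      case 1
      \<comment> \<open>Here \<open>s a\<close> itself is the member of the interval that is not
        increasing.\<close>
      then have "ascent k a" "s a \<notin> ?D" by (auto simp: F_def)
      moreover have "perm_le a (s a)" "perm_le (s a) b"
        using ascent_le[OF k(1,2) perm[OF ab(1)]] lift(2)[OF perm[OF ab(1)] perm[OF ab(2)] ab(3)]
          calculation k(3) by (auto simp: s_def)
      ultimately have "\<not> full a b" using s_perm[OF perm[OF ab(1)]] by (auto simp: full_def)
      then show ?thesis using mu_from_fixed[OF ab(2) 1 bL] by simp
    next
      case 2
      then have asb: "(a, s b) \<in> ?r" using lift_down[OF less.prems _ bL] by simp
      have "full a b \<longleftrightarrow> full a (s b)"
        using full_up[OF 2] full_mono[OF _ perm_le_refl sb(2)] by blast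
      then show ?thesis
        using mu_from_up[OF ab(2) 2 less.prems] bL IH[OF _ asb] count_b by simp
    next
      case 3
      have sa: "s a \<in> U" "perm_le (s a) a" "s a \<in> ?D" "ascent k (s a)"
        using s_down[OF 3] down_le[OF 3] down[OF 3] by (auto simp: rel U_def)
      have na: "\<not> ascent k a" using 3 by (simp add: L_def)
      have ss_le: "perm_le (s a) (s b)"
        using lift(4)[OF perm[OF ab(1)] perm[OF ab(2)] ab(3)] na k(3) by simp
      \<comment> \<open>For an ascent \<open>c\<close> the image \<open>s c\<close> is a descent
        between \<open>a\<close> and \<open>b\<close>, and descending from it gives \<open>c\<close>
        back; a descent \<open>c\<close> already lies between \<open>a\<close> and
        \<open>b\<close>.\<close>
      have "full (s a) (s b)" if f: "full a b"
        unfolding full_def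
      proof (intro allI impI)
        fix c assume c: "c permutes {1..m}" "perm_le (s a) c" "perm_le c (s b)"
        show "c \<in> ?D"
        proof (cases "ascent k c")
          case True
          then have "perm_le a (s c)" "perm_le (s c) b"
            using lift(3)[OF perm[OF sa(3)] c(1,2)] lift(3)[OF c(1) perm[OF sb(1)] c(3)] sa sb
            by auto
          then have "s c \<in> L"
            using f s_perm[OF c(1)] True asc[OF c(1)] by (simp add: full_def L_def)
          then show ?thesis using down by force
        next
          case False
          then have "perm_le a c"
            using lift(2)[OF perm[OF sa(3)] c(1,2)] sa by simp
          then show ?thesis using f c perm_le_trans[OF c(3) sb(2)] by (simp add: full_def)
        qed
      qed
      moreover have "full a b" if "full (s a) (s b)"
        using full_mono[OF full_up[OF sa(1) that] sa(2) perm_le_refl] .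
      ultimately have "full a b \<longleftrightarrow> full (s a) (s b)" by blast
      moreover have "inv_count m a = Suc (inv_count m (s a))"
        using inv_count_descent[OF k(1,2) perm[OF ab(1)] na] by (simp add: s_def)
      moreover have "(s a, s b) \<in> ?r" using sa sb ss_le by (simp add: rel)
      ultimately show ?thesis
        using mu_down_down[OF 3 bL less.prems] IH[of "s b" "s a"] count_b by simp
    qed
  qed
  then show ?case by (simp add: full_def)
qed

end

section \<open>Dominant compositions\<close>

text \<open>An isomorphism carries the index set of the defining sum to its counterpart, so
  induction along the recursion of \<open>moebius\<close> applies.\<close>

lemma moebius_transfer:
  assumes "finite A" "partial_order_on A r" "finite B" "partial_order_on B r'"
    and "bij_betw g A B"
    and "\<And>x y. x \<in> A \<Longrightarrow> y \<in> A \<Longrightarrow> (g x, g y) \<in> r' \<longleftrightarrow> (x, y) \<in> r"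
    and "x \<in> A" "y \<in> A"
  shows "moebius B r' (g x) (g y) = moebius A r x y"
  using assms
proof (induction A r x y rule: moebius.induct)
  case (1 A r x y)
  note rel = "1.prems"(6)
  have inj: "inj_on g A" and B: "B = g ` A" using "1.prems"(5) by (auto simp: bij_betw_def)
  show ?case
  proof (cases "(x, y) \<in> r \<and> x \<noteq> y")
    case True
    let ?Z = "{z. (x, z) \<in> r \<and> (z, y) \<in> r \<and> z \<noteq> y}"
    have car: "u \<in> A \<and> w \<in> A" if "(u, w) \<in> r" for u w
      using "1.prems"(2) that by (auto simp: partial_order_on_def preorder_on_def refl_on_def)
    have car': "u \<in> B \<and> w \<in> B" if "(u, w) \<in> r'" for u w
      using "1.prems"(4) that by (auto simp: partial_order_on_def preorder_on_def refl_on_def)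
    have neq: "g x \<noteq> g y" using True inj "1.prems" by (auto dest: inj_onD)
    have "{z. (g x, z) \<in> r' \<and> (z, g y) \<in> r' \<and> z \<noteq> g y} = g ` ?Z"
    proof safe
      fix w assume w: "(g x, w) \<in> r'" "(w, g y) \<in> r'" "w \<noteq> g y"
      then obtain z where "w = g z" "z \<in> A" using car' B by blast
      then show "w \<in> g ` ?Z" using w rel "1.prems" by auto
    qed (use rel "1.prems" car inj in \<open>auto dest: inj_onD\<close>)
    moreover have "inj_on g ?Z"
      by (rule inj_on_subset[OF inj]) (auto dest: car)
    ultimately have "(\<Sum>w\<in>{z. (g x, z) \<in> r' \<and> (z, g y) \<in> r' \<and> z \<noteq> g y}. moebius B r' (g x) w) =
        (\<Sum>z\<in>?Z. moebius B r' (g x) (g z))"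
      by (simp add: sum.reindex)
    also have "\<dots> = (\<Sum>z\<in>?Z. moebius A r x z)"
      using True "1.prems" car by (intro sum.cong refl "1.IH") auto
    finally show ?thesis
      using moebius_less[OF "1.prems"(1,2), of x y] moebius_less[OF "1.prems"(3,4) _ neq]
        rel "1.prems" True by simp
  next
    case False
    then show ?thesis
      using moebius_refl[OF "1.prems"(1,2)] moebius_refl[OF "1.prems"(3,4)] B
        moebius_not_le[OF "1.prems"(1,2)] moebius_not_le[OF "1.prems"(3,4)] rel "1.prems"
      by (cases "x = y") auto
  qed
qed

section \<open>Rearrangements of a regular composition as permutations\<close>

context
  fixes m :: nat and lam :: composition
  assumes regular: "\<forall>i\<in>{1..m}. \<forall>j\<in>{1..m}. i < j \<longrightarrow> lam i > lam j"
begin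

lemma lam_less_iff:
  assumes "i \<in> {1..m}" "j \<in> {1..m}"
  shows "lam i < lam j \<longleftrightarrow> j < i"
proof -
  have "lam w < lam u" if "u \<in> {1..m}" "w \<in> {1..m}" "u < w" for u w
    using bspec[OF bspec[OF regular that(1)] that(2)] that(3) by (rule mp)
  then show ?thesis using assms by (metis less_asym linorder_neqE_nat)
qed

lemma lam_perm_less_iff:
  assumes "p permutes {1..m}" "i \<in> {1..m}" "j \<in> {1..m}"
  shows "(lam \<circ> p) i < (lam \<circ> p) j \<longleftrightarrow> p j < p i"
proof -
  have "p i \<in> {1..m}" "p j \<in> {1..m}"
    by (simp_all only: permutes_in_image[OF assms(1)] assms(2,3))
  then show ?thesis using lam_less_iff by simp
qed

lemma inj_lam_perm: "inj_on (\<lambda>p. lam \<circ> p) {p. p permutes {1..m}}"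
proof (rule inj_onI, rule ext)
  fix p q i assume "p \<in> {p. p permutes {1..m}}" "q \<in> {p. p permutes {1..m}}"
    and eq: "lam \<circ> p = lam \<circ> q"
  then have pq: "p permutes {1..m}" "q permutes {1..m}" by simp_all
  show "p i = q i"
  proof (cases "i \<in> {1..m}")
    case True
    then have "p i \<in> {1..m}" "q i \<in> {1..m}"
      by (simp_all only: permutes_in_image[OF pq(1)] permutes_in_image[OF pq(2)])
    moreover have "lam (p i) = lam (q i)" using eq by (metis comp_apply)
    ultimately show ?thesis by (metis lam_less_iff linorder_neqE_nat less_irrefl)
  next
    case False
    then show ?thesis using permutes_not_in[OF pq(1)] permutes_not_in[OF pq(2)] by simp
  qed
qed

text \<open>\<open>lam\<close> reverses the order, so the pairs counted by \<open>rk\<close> are the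
  inversions of \<open>p\<close>.\<close>

lemma rk_lam_perm:
  assumes "p permutes {1..m}" shows "rk m (lam \<circ> p) = inv_count m p"
proof -
  have "{(i, j). i \<in> {1..m} \<and> j \<in> {1..m} \<and> i < j \<and> (lam \<circ> p) i < (lam \<circ> p) j} = inversions m p"
    using lam_perm_less_iff[OF assms] unfolding inversions_def by blast
  then show ?thesis unfolding rk_def inv_count_def by simp
qed

lemma bruhat_step_lam_perm:
  assumes "p permutes {1..m}"
  shows "(lam \<circ> p, c) \<in> bruhat_step m \<longleftrightarrow> (\<exists>q. c = lam \<circ> q \<and> (p, q) \<in> perm_step m)"
proof
  assume "(lam \<circ> p, c) \<in> bruhat_step m"
  then obtain i j where ij: "c = lam \<circ> p \<circ> transpose i j" "i \<in> {1..m}" "j \<in> {1..m}" "i < j"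
      "(lam \<circ> p) j < (lam \<circ> p) i"
    unfolding bruhat_step_def by blast
  then have "(p, p \<circ> transpose i j) \<in> perm_step m"
    using perm_stepI[OF assms] lam_perm_less_iff[OF assms] by blast
  then show "\<exists>q. c = lam \<circ> q \<and> (p, q) \<in> perm_step m" using ij(1) by (metis comp_assoc)
next
  assume "\<exists>q. c = lam \<circ> q \<and> (p, q) \<in> perm_step m"
  then obtain q where q: "c = lam \<circ> q" "(p, q) \<in> perm_step m" by blast
  then obtain i j where ij: "q = p \<circ> transpose i j" "i \<in> {1..m}" "j \<in> {1..m}" "i < j" "p i < p j"
    by (elim perm_stepE)
  have "(lam \<circ> p) j < (lam \<circ> p) i" using lam_perm_less_iff[OF assms] ij by blast
  moreover have "c = (lam \<circ> p) \<circ> transpose i j" using q(1) ij(1) by (simp add: comp_assoc)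
  ultimately show "(lam \<circ> p, c) \<in> bruhat_step m"
    using ij unfolding bruhat_step_def by blast
qed

lemma bruhat_lam_perm:
  assumes p: "p permutes {1..m}" and q: "q permutes {1..m}"
  shows "(lam \<circ> p, lam \<circ> q) \<in> bruhat m lam \<longleftrightarrow> perm_le p q"
proof
  \<comment> \<open>A chain of compositions lifts step by step to permutations starting at
    \<open>p\<close>; injectivity identifies its end with \<open>q\<close>.\<close>
  have "\<exists>u. c = lam \<circ> u \<and> u permutes {1..m} \<and> (p, u) \<in> (perm_step m)\<^sup>*"
    if "(lam \<circ> p, c) \<in> (bruhat_step m)\<^sup>*" for c
    using that
  proof induction
    case base
    then show ?case using p by blast
  next
    case (step c d)
    then obtain u where u: "c = lam \<circ> u" "u permutes {1..m}" "(p, u) \<in> (perm_step m)\<^sup>*"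
      by blast
    then obtain w where w: "d = lam \<circ> w" "(u, w) \<in> perm_step m"
      using step.hyps(2) bruhat_step_lam_perm[OF u(2)] by blast
    have "(p, w) \<in> (perm_step m)\<^sup>*" using u(3) w(2) by (rule rtrancl_into_rtrancl)
    then show ?case using w(1) perm_step_permutes(2)[OF w(2)] by blast
  qed
  moreover assume "(lam \<circ> p, lam \<circ> q) \<in> bruhat m lam"
  ultimately obtain u where "lam \<circ> q = lam \<circ> u" "u permutes {1..m}" "(p, u) \<in> (perm_step m)\<^sup>*"
    unfolding bruhat_def by blast
  then show "perm_le p q" using inj_lam_perm q perm_steps_imp_le by (metis inj_onD mem_Collect_eq)
next
  assume "perm_le p q"
  then have "(p, q) \<in> (perm_step m)\<^sup>*" by (rule perm_le_imp_steps[OF p q])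
  then have "(lam \<circ> p, lam \<circ> q) \<in> (bruhat_step m)\<^sup>*"
  proof induction
    case (step u w)
    then have "(lam \<circ> u, lam \<circ> w) \<in> bruhat_step m"
      using bruhat_step_lam_perm perm_step_permutes(1) by blast
    then show ?case by (rule rtrancl_into_rtrancl[OF step.IH])
  qed simp
  then show "(lam \<circ> p, lam \<circ> q) \<in> bruhat m lam"
    using p q unfolding bruhat_def rearrangements_def by blast
qed

text \<open>In a pair of \<open>R\<close> the position of the larger element comes first, since
  \<open>v\<close> reverses the order.\<close>

context
  fixes S :: "'a set" and r :: "'a rel" and v :: "'a \<Rightarrow> nat" and R :: "nat rel"
  assumes anti: "consistent_anti_linearization m S r v" and bij: "bij_betw v S {1..m}"
  defines "R \<equiv> {(v s, v t) | s t. s \<in> S \<and> t \<in> S \<and> (t, s) \<in> r \<and> s \<noteq> t}"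
begin

lemma position_less: "(i, j) \<in> R \<Longrightarrow> 1 \<le> i \<and> i < j"
  using anti by (auto simp: R_def consistent_anti_linearization_def)

text \<open>The elements above \<open>t\<close> fill an interval of positions containing
  \<open>v s\<close> and \<open>v t\<close>, hence also \<open>h\<close>, which bijectivity of
  \<open>v\<close> assigns to some element.\<close>

lemma position_convex:
  assumes "(i, j) \<in> R" "i \<le> h" "h < j"
  shows "(h, j) \<in> R"
proof -
  obtain s t where st: "i = v s" "j = v t" "s \<in> S" "t \<in> S" "(t, s) \<in> r"
    using assms(1) by (auto simp: R_def)
  have rng: "v ` S = {1..m}" using bij by (simp add: bij_betw_def)
  have "h \<in> {1..m}" using assms st rng by (metis atLeastAtMost_iff imageI le_trans less_imp_le)
  then obtain u where u: "h = v u" "u \<in> S" using rng by (metis imageE)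
  obtain c d where cd: "{x \<in> S. (t, x) \<in> r} = {x \<in> S. v x \<in> {c..d}}"
    using anti st(4) unfolding consistent_anti_linearization_def by blast
  have "(t, t) \<in> r"
    using anti st(4)
    by (auto simp: consistent_anti_linearization_def partial_order_on_def preorder_on_def refl_on_def)
  then have "c \<le> v s" "v t \<le> d" using cd st by auto
  then have "u \<in> {x \<in> S. v x \<in> {c..d}}" using u st(1,2) assms(2,3) by simp
  then have "(t, u) \<in> r" unfolding cd[symmetric] by simp
  then show ?thesis using u st(2,4) assms(3) unfolding R_def by blast
qed

lemma dominant_lam_perm:
  assumes "p permutes {1..m}"
  shows "dominant m S r v (lam \<circ> p) \<longleftrightarrow> p \<in> increasing_perms m R"
proof -
  have rng: "v ` S = {1..m}" using bij by (simp add: bij_betw_def)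
  \<comment> \<open>Regularity makes the entries distinct, so the weak inequality of dominance
    becomes a strict one for \<open>p\<close>.\<close>
  have iff: "(lam \<circ> p) (v t) \<le> (lam \<circ> p) (v s) \<longleftrightarrow> p (v s) < p (v t)"
    if "s \<in> S" "t \<in> S" "s \<noteq> t" for s t
  proof -
    have "v s \<noteq> v t" using that bij by (auto simp: bij_betw_def dest: inj_onD)
    then have "p (v s) \<noteq> p (v t)" using permutes_inj[OF assms] by (auto dest: injD)
    moreover have "v s \<in> {1..m}" "v t \<in> {1..m}" using that rng by blast+
    ultimately show ?thesis
      using lam_perm_less_iff[OF assms, of "v s" "v t"] by (metis linorder_not_le nat_less_le)
  qed
  have "dominant m S r v (lam \<circ> p) \<longleftrightarrow>
      (\<forall>s\<in>S. \<forall>t\<in>S. (t, s) \<in> r \<and> s \<noteq> t \<longrightarrow> p (v s) < p (v t))"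
    unfolding dominant_def rng using iff by auto
  also have "\<dots> \<longleftrightarrow> (\<forall>i j. (i, j) \<in> R \<longrightarrow> p i < p j)"
    unfolding R_def by blast
  finally show ?thesis using assms by (simp add: increasing_perms_def)
qed

lemma dominant_rearrangements_eq:
  "dominant_rearrangements m S r v lam = (\<lambda>p. lam \<circ> p) ` increasing_perms m R"
proof -
  have "dominant_rearrangements m S r v lam =
      (\<lambda>p. lam \<circ> p) ` {p. p permutes {1..m} \<and> dominant m S r v (lam \<circ> p)}"
    unfolding dominant_rearrangements_def rearrangements_def by blast
  also have "{p. p permutes {1..m} \<and> dominant m S r v (lam \<circ> p)} = increasing_perms m R"
    using dominant_lam_perm increasing_perms_permutes[of _ m R] by auto
  finally show ?thesis .
qed

lemma dominant_bruhat_lam_perm: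
  assumes "p permutes {1..m}" "q permutes {1..m}"
  shows "(lam \<circ> p, lam \<circ> q) \<in> dominant_bruhat m S r v lam \<longleftrightarrow> (p, q) \<in> increasing_order m R"
proof -
  have "lam \<circ> u \<in> dominant_rearrangements m S r v lam \<longleftrightarrow> u \<in> increasing_perms m R"
    if "u permutes {1..m}" for u
  proof -
    have "lam \<circ> u \<in> rearrangements m lam" unfolding rearrangements_def using that by blast
    then show ?thesis using dominant_lam_perm[OF that] by (simp add: dominant_rearrangements_def)
  qed
  then show ?thesis
    unfolding dominant_bruhat_def increasing_order_def
    using assms bruhat_lam_perm[OF assms] by auto
qed

lemma moebius_dominant_rearrangements:
  assumes ab: "(a, b) \<in> dominant_bruhat m S r v lam"
  shows "moebius (dominant_rearrangements m S r v lam) (dominant_bruhat m S r v lam) a b =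
    (if \<forall>c \<in> open_interval (bruhat m lam) a b. dominant m S r v c
     then (-1) ^ (rk m b - rk m a) else 0)"
proof -
  let ?D = "increasing_perms m R" and ?B = "dominant_rearrangements m S r v lam"
  have "a \<in> ?B" "b \<in> ?B" using ab by (auto simp: dominant_bruhat_def)
  then obtain p q where pq: "a = lam \<circ> p" "b = lam \<circ> q" "p \<in> ?D" "q \<in> ?D"
    unfolding dominant_rearrangements_eq by blast
  have D_perm: "u permutes {1..m}" if "u \<in> ?D" for u
    using that by (rule increasing_perms_permutes)
  note perm = D_perm[OF pq(3)] D_perm[OF pq(4)]
  have pq_le: "(p, q) \<in> increasing_order m R" "perm_le p q"
    using ab dominant_bruhat_lam_perm[OF perm] pq by (auto simp: increasing_order_def)
  have "inj_on (\<lambda>p. lam \<circ> p) ?D"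
    by (rule inj_on_subset[OF inj_lam_perm]) (use D_perm in blast)
  then have "bij_betw (\<lambda>p. lam \<circ> p) ?D ?B"
    unfolding dominant_rearrangements_eq by (rule inj_on_imp_bij_betw)
  then have "moebius ?B (dominant_bruhat m S r v lam) (lam \<circ> p) (lam \<circ> q) =
      moebius ?D (increasing_order m R) p q"
    using dominant_bruhat_lam_perm[OF D_perm D_perm] pq(3,4)
    by (rule moebius_transfer[OF finite_increasing_perms partial_order_increasing
        finite_dominant_rearrangements partial_order_dominant_bruhat])
  then have "moebius ?B (dominant_bruhat m S r v lam) a b = moebius ?D (increasing_order m R) p q"
    by (simp only: pq(1,2))
  also have "\<dots> = (if \<forall>c. c permutes {1..m} \<longrightarrow> perm_le p c \<longrightarrow> perm_le c q \<longrightarrow> c \<in> ?D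
     then (-1) ^ (inv_count m p + inv_count m q) else 0)"
    by (rule moebius_increasing_perms) (use position_less position_convex pq_le in \<open>blast+\<close>)
  \<comment> \<open>The closed interval of permutations may be traded for the open one because the
    endpoints are dominant.\<close>
  also have "(\<forall>c. c permutes {1..m} \<longrightarrow> perm_le p c \<longrightarrow> perm_le c q \<longrightarrow> c \<in> ?D) \<longleftrightarrow>
      (\<forall>c \<in> open_interval (bruhat m lam) a b. dominant m S r v c)"
  proof safe
    fix c assume all: "\<forall>c. c permutes {1..m} \<longrightarrow> perm_le p c \<longrightarrow> perm_le c q \<longrightarrow> c \<in> ?D"
      and c: "c \<in> open_interval (bruhat m lam) a b"
    then obtain w where w: "c = lam \<circ> w" "w permutes {1..m}"
      by (auto simp: open_interval_def bruhat_def rearrangements_def)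
    then show "dominant m S r v c"
      using c all bruhat_lam_perm perm dominant_lam_perm by (auto simp: open_interval_def pq)
  next
    fix w assume all: "\<forall>c \<in> open_interval (bruhat m lam) a b. dominant m S r v c"
      and w: "w permutes {1..m}" "perm_le p w" "perm_le w q"
    show "w \<in> ?D"
    proof (cases "lam \<circ> w = a \<or> lam \<circ> w = b")
      case True
      then show ?thesis using pq perm w inj_lam_perm by (metis inj_onD mem_Collect_eq)
    next
      case False
      then have "lam \<circ> w \<in> open_interval (bruhat m lam) a b"
        using w bruhat_lam_perm perm by (simp add: open_interval_def pq)
      then show ?thesis using all dominant_lam_perm w by blast
    qed
  qed
  \<comment> \<open>Sum and difference have the same parity once monotonicity of the length rules
    out truncation.\<close>
  also have "(-1::int) ^ (inv_count m p + inv_count m q) = (-1) ^ (rk m b - rk m a)"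
  proof -
    have "inv_count m p \<le> inv_count m q" by (rule inv_count_mono[OF perm pq_le(2)])
    then show ?thesis
      unfolding pq(1,2) rk_lam_perm[OF perm(1)] rk_lam_perm[OF perm(2)]
      by (simp add: minus_one_power_iff)
  qed
  finally show ?thesis .
qed

end

end

theorem corollary2p34:
  fixes m :: nat and S :: "'a set" and r :: "'a rel" and v :: "'a \<Rightarrow> nat"
    and lam a b :: composition
  assumes "consistent_anti_linearization m S r v"
    and "bij_betw v S {1..m}"
    and "lam \<in> compositions m"
    and "\<forall>i\<in>{1..m}. \<forall>j\<in>{1..m}. i < j \<longrightarrow> lam i > lam j"
    and "a \<in> dominant_rearrangements m S r v lam"
    and "b \<in> dominant_rearrangements m S r v lam"
    and "(a, b) \<in> dominant_bruhat m S r v lam"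
  shows
    "moebius (dominant_rearrangements m S r v lam) (dominant_bruhat m S r v lam) a b =
       (if open_interval (bruhat m lam) a b = open_interval (dominant_bruhat m S r v lam) a b
        then (-1) ^ (rk m b - rk m a) else 0)
     \<and>
     (if \<forall>c \<in> open_interval (bruhat m lam) a b. dominant m S r v c
      then moebius (dominant_rearrangements m S r v lam) (dominant_bruhat m S r v lam) a b \<in> {1, -1}
      else moebius (dominant_rearrangements m S r v lam) (dominant_bruhat m S r v lam) a b = 0)"
proof -
  \<comment> \<open>The dominant order is a restriction, so its open interval consists of the
    dominant members of the larger one.\<close>
  have "open_interval (bruhat m lam) a b = open_interval (dominant_bruhat m S r v lam) a b \<longleftrightarrow>
      (\<forall>c \<in> open_interval (bruhat m lam) a b. dominant m S r v c)"
    using assms(5,6)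
    by (auto simp: open_interval_def dominant_bruhat_def dominant_rearrangements_def bruhat_def)
  then show ?thesis
    using moebius_dominant_rearrangements[OF assms(4,1,2,7)] by (simp add: minus_one_power_iff)
qed

end
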